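(* Let $M_k$ be any optimal cardinality-$k$ matching, where $0\le k<K$. Then there exists an optimal cardinality-$(k+1)$ matching $M_{k+1}$ such that $A(M_{k+1})=A(M_k)\cup\{x,y\}$ for some source atom $x\notin A(M_k)$ and some target atom $y\notin A(M_k)$.
   Context: Fix $L>0$, $w>0$ and integers $n,m\ge 1$. The circle is $\mathbb{S}^1_L=\mathbb{R}/L\mathbb{Z}$, with points represented by coordinates in $[0,L)$ and geodesic distance $d(x,y)=\min\{|x-y|,\,L-|x-y|\}$. Let $x_1,\dots,x_n$ (source atoms) and $y_1,\dots,y_m$ (target atoms) be points of the circle, all $N=n+m$ of them pairwise distinct, each carrying the same mass $w$. Put $K=\min(n,m)$. A matching $M$ is a set of pairs $(x_i,y_j)$ in which no atom appears in more than one pair; its cost is $w\sum_{(x_i,y_j)\in M}d(x_i,y_j)$. For $0\le k\le K$, $C_k^\circ$ is the minimum cost over all matchings with $|M|=k$, and a matching with $|M|=k$ and cost $C_k^\circ$ is called an optimal cardinality-$k$ matching. The active set $A(M)$ is the set of all source and target atoms incident to a pair of $M$. *)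

theory Defs
  imports Complex_Main
begin

text \<open>A point of the circle of circumference \<open>L\<close> is represented by its coordinate in
  \<open>{0..<L}\<close>. All atoms sit at pairwise distinct points, so an atom is identified
  with its point: \<open>X\<close> and \<open>Y\<close> below are the (disjoint) sets of source and target atoms.\<close>

definition circle_dist :: "real \<Rightarrow> real \<Rightarrow> real \<Rightarrow> real" where
  "circle_dist L x y = min \<bar>x - y\<bar> (L - \<bar>x - y\<bar>)"

definition matching :: "real set \<Rightarrow> real set \<Rightarrow> (real \<times> real) set \<Rightarrow> bool" where
  "matching X Y M \<longleftrightarrow> M \<subseteq> X \<times> Y \<and> inj_on fst M \<and> inj_on snd M"

definition matching_cost :: "real \<Rightarrow> real \<Rightarrow> (real \<times> real) set \<Rightarrow> real" where
  "matching_cost L w M = w * (\<Sum>(x, y)\<in>M. circle_dist L x y)"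

text \<open>For finite \<open>X\<close>, \<open>Y\<close> and \<open>k \<le> min (card X) (card Y)\<close> the minimum is taken over a finite
  nonempty set.\<close>

definition min_cost :: "real \<Rightarrow> real \<Rightarrow> real set \<Rightarrow> real set \<Rightarrow> nat \<Rightarrow> real" where
  "min_cost L w X Y k = Min (matching_cost L w ` {M. matching X Y M \<and> card M = k})"

definition optimal_matching ::
  "real \<Rightarrow> real \<Rightarrow> real set \<Rightarrow> real set \<Rightarrow> nat \<Rightarrow> (real \<times> real) set \<Rightarrow> bool" where
  "optimal_matching L w X Y k M \<longleftrightarrow>
     matching X Y M \<and> card M = k \<and> matching_cost L w M = min_cost L w X Y k"

definition active_set :: "(real \<times> real) set \<Rightarrow> real set" where
  "active_set M = fst ` M \<union> snd ` M"

end

theory Submission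
  imports Defs
begin

text \<open>Let \<open>M\<close> be optimal of cardinality \<open>k\<close> and \<open>N\<close> optimal of cardinality \<open>k + 1\<close>. Swapping
  \<open>M\<close> and \<open>N\<close> along an augmenting path of their symmetric difference gives matchings \<open>M'\<close>, \<open>N'\<close>
  of cardinalities \<open>k + 1\<close> and \<open>k\<close> with the same total cost. As \<open>N'\<close> costs at least as much as
  \<open>M\<close>, the matching \<open>M'\<close> costs at most as much as \<open>N\<close>, so it is optimal; and \<open>M'\<close> covers the
  atoms of \<open>M\<close> together with the two ends of the path. The geometry of the circle plays no role.\<close>

text \<open>The induction contracts the first two edges \<open>(p, q) \<in> N\<close>, \<open>(r, q) \<in> M\<close> of an alternating
  path that starts at a vertex \<open>p\<close> not covered by \<open>M\<close>. If the path found in the rest starts at \<open>r\<close>,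
  the two edges are swapped as well; otherwise they are kept.\<close>

lemma augmenting_exchange:
  fixes M N :: "('a \<times> 'b) set" and f :: "'a \<times> 'b \<Rightarrow> 'c::comm_monoid_add"
  assumes "finite M" "finite N" "inj_on fst M" "inj_on snd M" "inj_on fst N" "inj_on snd N"
    and "card M < card N"
  shows "\<exists>M' N' a b. M' \<subseteq> M \<union> N \<and> N' \<subseteq> M \<union> N \<and>
           inj_on fst M' \<and> inj_on snd M' \<and> inj_on fst N' \<and> inj_on snd N' \<and>
           card M' = card M + 1 \<and> card N = card N' + 1 \<and>
           sum f M' + sum f N' = sum f M + sum f N \<and>
           a \<in> fst ` N - fst ` M \<and> b \<in> snd ` N - snd ` M \<and>
           fst ` M' = insert a (fst ` M) \<and> snd ` M' = insert b (snd ` M) \<and>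
           fst ` N' = fst ` N - {a} \<and> snd ` N' = snd ` N - {b}"
  using assms
proof (induction "card M" arbitrary: M N rule: less_induct)
  case less
  note fin = less.prems(1,2) and inj = less.prems(3-6)
  have "card (fst ` M) < card (fst ` N)"
    using less.prems by (simp add: card_image)
  then have "\<not> fst ` N \<subseteq> fst ` M"
    using fin card_mono[of "fst ` M" "fst ` N"] by force
  then obtain p q where pq: "(p, q) \<in> N" and p: "p \<notin> fst ` M"
    by force
  define N1 where "N1 = N - {(p, q)}"
  have N: "N = insert (p, q) N1" and pqN1: "(p, q) \<notin> N1"
    using pq by (auto simp: N1_def)
  have N1: "finite N1" "inj_on fst N1" "inj_on snd N1" "p \<notin> fst ` N1" "q \<notin> snd ` N1"
    using fin inj pqN1 unfolding N by auto
  show ?case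
  proof (cases "q \<in> snd ` M")
    case False
    \<comment> \<open>Both ends of \<open>(p, q)\<close> are free in \<open>M\<close>, so this edge
      alone is the augmenting path: it moves from \<open>N\<close> to \<open>M\<close>.\<close>
    have "(p, q) \<notin> M"
      using p by force
    then show ?thesis
      using fin inj N1 p False pqN1
      by - (rule exI[of _ "insert (p, q) M"], rule exI[of _ N1], rule exI[of _ p],
          rule exI[of _ q], auto simp: N ac_simps)
  next
    case True
    then obtain r where rq: "(r, q) \<in> M"
      by force
    define M1 where "M1 = M - {(r, q)}"
    have M: "M = insert (r, q) M1" and rqM1: "(r, q) \<notin> M1"
      using rq by (auto simp: M1_def)
    have M1: "finite M1" "inj_on fst M1" "inj_on snd M1" "r \<notin> fst ` M1" "q \<notin> snd ` M1"
      using fin inj rqM1 unfolding M by auto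
    have pr: "p \<noteq> r" "p \<notin> fst ` M1"
      using p unfolding M by auto
    have "card M1 < card M" "card M1 < card N1"
      using M1(1) N1(1) rqM1 pqN1 less.prems(7) unfolding M N by auto
    with less.hyps[of M1 N1] M1 N1 obtain M' N' a b where
      sub: "M' \<subseteq> M1 \<union> N1" "N' \<subseteq> M1 \<union> N1" and
      inj': "inj_on fst M'" "inj_on snd M'" "inj_on fst N'" "inj_on snd N'" and
      card: "card M' = card M1 + 1" "card N1 = card N' + 1" and
      sum: "sum f M' + sum f N' = sum f M1 + sum f N1" and
      ab: "a \<in> fst ` N1 - fst ` M1" "b \<in> snd ` N1 - snd ` M1" and
      im: "fst ` M' = insert a (fst ` M1)" "snd ` M' = insert b (snd ` M1)"
        "fst ` N' = fst ` N1 - {a}" "snd ` N' = snd ` N1 - {b}"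
      by metis
    have fin': "finite M'" "finite N'"
      using sub M1(1) N1(1) by (auto intro: finite_subset)
    have ends: "a \<noteq> p" "b \<noteq> q"
      using ab N1 by auto
    have fresh: "q \<notin> snd ` M'" "q \<notin> snd ` N'" "p \<notin> fst ` M'" "p \<notin> fst ` N'"
      using M1 N1 pr ends by (auto simp: im)
    \<comment> \<open>Neither \<open>M'\<close> nor \<open>N'\<close> touches \<open>q\<close>, so
      adding either contracted edge adds exactly one to the cardinality and one summand to the
      sum.\<close>
    have edges: "(s, q) \<notin> M'" "(s, q) \<notin> N'" for s
      using fresh by force+
    show ?thesis
    \<comment> \<open>The end \<open>a\<close> is only known to be free in \<open>M1\<close>, so it
      may be \<open>r\<close>, which lost its edge in the contraction.\<close>
    proof (cases "a = r")
      case True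
      \<comment> \<open>The exchange moved \<open>r\<close> from the sources of \<open>N'\<close> to
        those of \<open>M'\<close>. Hence \<open>(r, q)\<close> fits into \<open>N'\<close> and
        \<open>(p, q)\<close> into \<open>M'\<close>, and the path now starts at
        \<open>p\<close>.\<close>
      have "r \<notin> fst ` N'"
        using True by (simp add: im)
      have im': "fst ` insert (p, q) M' = insert p (fst ` M)"
        "snd ` insert (p, q) M' = insert b (snd ` M)"
        "fst ` insert (r, q) N' = fst ` N - {p}" "snd ` insert (r, q) N' = snd ` N - {b}"
        using im True ab N1 ends by (auto simp: M N)
      have "sum f (insert (p, q) M') + sum f (insert (r, q) N')
          = (f (p, q) + f (r, q)) + (sum f M' + sum f N')"
        using fin' edges by (simp add: ac_simps)
      also have "\<dots> = sum f M + sum f N"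
        using M1 N1 rqM1 pqN1 by (simp add: sum M N ac_simps)
      finally have sum': "sum f (insert (p, q) M') + sum f (insert (r, q) N')
          = sum f M + sum f N" .
      show ?thesis
        using sub inj' fin' fresh edges card M1(1) N1(1) rqM1 pqN1 ab ends p \<open>r \<notin> fst ` N'\<close>
        by - (rule exI[of _ "insert (p, q) M'"], rule exI[of _ "insert (r, q) N'"],
            rule exI[of _ p], rule exI[of _ b], intro conjI im' sum', auto simp: M N)
    next
      case False
      \<comment> \<open>The path avoids \<open>r\<close>, so each contracted edge returns to its own
        side and the ends remain \<open>a\<close> and \<open>b\<close>.\<close>
      have "r \<notin> fst ` M'"
        using False M1 by (simp add: im)
      have im': "fst ` insert (r, q) M' = insert a (fst ` M)"
        "snd ` insert (r, q) M' = insert b (snd ` M)"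
        "fst ` insert (p, q) N' = fst ` N - {a}" "snd ` insert (p, q) N' = snd ` N - {b}"
        using im ends by (auto simp: M N)
      have "sum f (insert (r, q) M') + sum f (insert (p, q) N')
          = (f (r, q) + f (p, q)) + (sum f M' + sum f N')"
        using fin' edges by (simp add: ac_simps)
      also have "\<dots> = sum f M + sum f N"
        using M1 N1 rqM1 pqN1 by (simp add: sum M N ac_simps)
      finally have sum': "sum f (insert (r, q) M') + sum f (insert (p, q) N')
          = sum f M + sum f N" .
      show ?thesis
        using sub inj' fin' fresh edges card M1(1) N1(1) rqM1 pqN1 ab ends False \<open>r \<notin> fst ` M'\<close>
        by - (rule exI[of _ "insert (r, q) M'"], rule exI[of _ "insert (p, q) N'"],
            rule exI[of _ a], rule exI[of _ b], intro conjI im' sum', auto simp: M N)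
    qed
  qed
qed

lemma finite_matchings:
  assumes "finite X" "finite Y"
  shows "finite {M. matching X Y M \<and> card M = k}"
  by (rule finite_subset[of _ "Pow (X \<times> Y)"]) (use assms in \<open>auto simp: matching_def\<close>)

lemma min_cost_le:
  assumes "finite X" "finite Y" "matching X Y M" "card M = k"
  shows "min_cost L w X Y k \<le> matching_cost L w M"
  unfolding min_cost_def using assms finite_matchings[of X Y k] by (auto intro!: Min_le)

text \<open>Ensures that the minimum in \<open>min_cost\<close> is attained. The graph of a
  bijection between \<open>k\<close>-element subsets of \<open>X\<close> and \<open>Y\<close> serves
  as the matching.\<close>

lemma matching_of_card_exists:
  assumes "finite X" "finite Y" "k \<le> card X" "k \<le> card Y"
  shows "\<exists>M. matching X Y M \<and> card M = k"
proof -
  obtain X' Y' where X': "X' \<subseteq> X" "card X' = k" and Y': "Y' \<subseteq> Y" "card Y' = k"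
    using assms by (meson obtain_subset_with_card_n)
  obtain g where g: "bij_betw g X' Y'"
    using X' Y' assms by (metis finite_same_card_bij finite_subset)
  have "inj_on (\<lambda>u. (u, g u)) X'"
    by (auto simp: inj_on_def)
  then have "card ((\<lambda>u. (u, g u)) ` X') = k"
    using X' by (simp add: card_image)
  moreover have "matching X Y ((\<lambda>u. (u, g u)) ` X')"
    using g X' Y' unfolding matching_def bij_betw_def inj_on_def by auto
  ultimately show ?thesis
    by blast
qed

lemma optimal_matching_exists:
  assumes "finite X" "finite Y" "k \<le> card X" "k \<le> card Y"
  shows "\<exists>M. optimal_matching L w X Y k M"
proof -
  have "min_cost L w X Y k \<in> matching_cost L w ` {M. matching X Y M \<and> card M = k}"
    unfolding min_cost_def
    using finite_matchings[of X Y k] matching_of_card_exists[of X Y k] assms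
    by (intro Min_in) auto
  then show ?thesis
    by (auto simp: optimal_matching_def)
qed

lemma optimal_matching_augment:
  assumes fin: "finite X" "finite Y" and "X \<inter> Y = {}" and "k < card X" "k < card Y"
    and opt: "optimal_matching L w X Y k M"
  shows "\<exists>M' a b. optimal_matching L w X Y (k + 1) M' \<and>
           a \<in> X \<and> a \<notin> active_set M \<and> b \<in> Y \<and> b \<notin> active_set M \<and>
           active_set M' = active_set M \<union> {a, b}"
proof -
  obtain N where N: "optimal_matching L w X Y (k + 1) N"
    using optimal_matching_exists[of X Y "k + 1"] assms by fastforce
  have M: "M \<subseteq> X \<times> Y" "inj_on fst M" "inj_on snd M" "card M = k"
    "matching_cost L w M = min_cost L w X Y k"
    using opt by (auto simp: optimal_matching_def matching_def)
  have N: "N \<subseteq> X \<times> Y" "inj_on fst N" "inj_on snd N" "card N = k + 1"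
    "matching_cost L w N = min_cost L w X Y (k + 1)"
    using N by (auto simp: optimal_matching_def matching_def)
  have "finite M" "finite N"
    using M(1) N(1) fin by (auto intro: finite_subset)
  let ?f = "\<lambda>(u, v). circle_dist L u v"
  obtain M' N' a b where sub: "M' \<subseteq> M \<union> N" "N' \<subseteq> M \<union> N" and
    inj: "inj_on fst M'" "inj_on snd M'" "inj_on fst N'" "inj_on snd N'" and
    card: "card M' = card M + 1" "card N = card N' + 1" and
    sum: "sum ?f M' + sum ?f N' = sum ?f M + sum ?f N" and
    ab: "a \<in> fst ` N - fst ` M" "b \<in> snd ` N - snd ` M" and
    im: "fst ` M' = insert a (fst ` M)" "snd ` M' = insert b (snd ` M)"
    using augmenting_exchange[of M N ?f, OF \<open>finite M\<close> \<open>finite N\<close> M(2,3) N(2,3)] M(4) N(4)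
    by (elim meta_impE exE conjE) auto
  have M': "matching X Y M'" "card M' = k + 1" and N': "matching X Y N'" "card N' = k"
    using sub inj card M N by (auto simp: matching_def)
  have "matching_cost L w M' + matching_cost L w N' = matching_cost L w M + matching_cost L w N"
    unfolding matching_cost_def using sum by (metis distrib_left)
  \<comment> \<open>Two lower bounds whose sum equals the total cost must both be
    equalities.\<close>
  with min_cost_le[OF fin M', of L w] min_cost_le[OF fin N', of L w]
  have "matching_cost L w M' = min_cost L w X Y (k + 1)"
    using M(5) N(5) by linarith
  with M' have "optimal_matching L w X Y (k + 1) M'"
    by (simp add: optimal_matching_def)
  moreover have "a \<in> X" "b \<in> Y"
    using ab N(1) by auto
  \<comment> \<open>\<open>active_set\<close> mixes sources and targets, so disjointness of
    \<open>X\<close> and \<open>Y\<close> rules out that \<open>a\<close> is a matched target or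
    \<open>b\<close> a matched source.\<close>
  moreover have "a \<notin> active_set M" "b \<notin> active_set M"
    using ab \<open>a \<in> X\<close> \<open>b \<in> Y\<close> \<open>X \<inter> Y = {}\<close> M(1) by (auto simp: active_set_def)
  moreover have "active_set M' = active_set M \<union> {a, b}"
    using im by (auto simp: active_set_def)
  ultimately show ?thesis
    by blast
qed

theorem theorem1:
  fixes L w :: real and n m k :: nat and x y :: "nat \<Rightarrow> real"
    and M :: "(real \<times> real) set"
  assumes "L > 0" and "w > 0" and "n \<ge> 1" and "m \<ge> 1"
    and "x ` {1..n} \<subseteq> {0..<L}" and "y ` {1..m} \<subseteq> {0..<L}"
    and "inj_on x {1..n}" and "inj_on y {1..m}" and "x ` {1..n} \<inter> y ` {1..m} = {}"
    and "k < min n m"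
    and "optimal_matching L w (x ` {1..n}) (y ` {1..m}) k M"
  shows "\<exists>M' a b. optimal_matching L w (x ` {1..n}) (y ` {1..m}) (k + 1) M' \<and>
           a \<in> x ` {1..n} \<and> a \<notin> active_set M \<and>
           b \<in> y ` {1..m} \<and> b \<notin> active_set M \<and>
           active_set M' = active_set M \<union> {a, b}"
  using assms by (intro optimal_matching_augment) (auto simp: card_image)

end
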